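(* The patterns $2134$ and $3241$ form a tied pair: $2134\equiv3241$, that is, $\Pr(2134\prec3241)=\Pr(3241\prec2134)=\frac12$.
   Context: For a sequence of distinct reals, $\mathrm{st}$ replaces the smallest entry by $1$, the second smallest by $2$, etc. Let $X_1,X_2,\dots$ be i.i.d. continuous random variables (e.g. uniform on $[0,1]$). A consecutive occurrence of a permutation $\sigma$ of $\{1,\dots,k\}$ is a block $X_i,\dots,X_{i+k-1}$ with $\mathrm{st}(X_i\dots X_{i+k-1})=\sigma$. For distinct permutations $\sigma,\tau$ of the same length, $\Pr(\sigma\prec\tau)$ is the probability that the first consecutive occurrence of $\sigma$ appears before the first consecutive occurrence of $\tau$. We write $\sigma\equiv\tau$ if $\Pr(\sigma\prec\tau)=\Pr(\tau\prec\sigma)=\frac12$. *)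

theory Defs
  imports "HOL-Probability.Probability"
begin

text \<open>Permutations of \<open>{1..k}\<close> are written in one-line notation, as lists of length \<open>k\<close>.\<close>

text \<open>If \<open>xs\<close> has repeated entries then so does \<open>st xs\<close>, so that \<open>st xs\<close> is not a permutation;
  blocks with ties are thus never occurrences of a pattern.\<close>

definition st :: "real list \<Rightarrow> nat list" where
  "st xs = map (\<lambda>x. card {y \<in> set xs. y \<le> x}) xs"

text \<open>Sequences are indexed from \<open>0\<close>.\<close>

definition occurs_at :: "nat list \<Rightarrow> (nat \<Rightarrow> real) \<Rightarrow> nat \<Rightarrow> bool" where
  "occurs_at \<sigma> x i \<longleftrightarrow> st (map x [i..<i + length \<sigma>]) = \<sigma>"

text \<open>Since \<open>Inf {} = \<infinity>\<close>, this is \<open>\<infinity>\<close> if there is no occurrence.\<close>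

definition first_occ :: "nat list \<Rightarrow> (nat \<Rightarrow> real) \<Rightarrow> enat" where
  "first_occ \<sigma> x = Inf (enat ` {i. occurs_at \<sigma> x i})"

definition prob_before :: "'a measure \<Rightarrow> (nat \<Rightarrow> 'a \<Rightarrow> real) \<Rightarrow> nat list \<Rightarrow> nat list \<Rightarrow> real" where
  "prob_before M X \<sigma> \<tau> =
     measure M {\<omega> \<in> space M. first_occ \<sigma> (\<lambda>i. X i \<omega>) < first_occ \<tau> (\<lambda>i. X i \<omega>)}"

definition tied :: "'a measure \<Rightarrow> (nat \<Rightarrow> 'a \<Rightarrow> real) \<Rightarrow> nat list \<Rightarrow> nat list \<Rightarrow> bool" where
  "tied M X \<sigma> \<tau> \<longleftrightarrow> prob_before M X \<sigma> \<tau> = 1/2 \<and> prob_before M X \<tau> \<sigma> = 1/2"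

end

theory Submission
  imports Defs
begin

text \<open>Both patterns start with a large entry, a smaller one and a still larger one. In a window
\<open>a, b, c, d\<close> with \<open>b < a < c\<close>, a final entry above \<open>c\<close> completes \<open>2134\<close> and a final entry below
\<open>b\<close> completes \<open>3241\<close>. So the two patterns reward opposite ends of the scale, and one hopes for an
antisymmetry under turning the scale upside down. It is not visible on single sequences, because
that turns \<open>2134\<close> and \<open>3241\<close> into the other patterns \<open>3421\<close> and \<open>2314\<close>, but it holds for
conditional expectations.

The common distribution function is continuous, so it may be applied to the variables (almost
surely it does not change their relative order). Thus the terms are uniform, and centring them
makes their distribution \<open>\<mu>\<close> invariant under negation. Let \<open>payoff n x\<close> be \<open>1\<close>, \<open>-1\<close> or \<open>0\<close>
according to whether the first of the two patterns to start among positions \<open>0, ..., n - 1\<close> of \<open>x\<close>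
is \<open>2134\<close>, is \<open>3241\<close>, or does not exist. Write \<open>G\<^sub>n c\<close> for the expected payoff of a random
sequence with first term \<open>c\<close>, \<open>F\<^sub>n a b\<close> for that of a sequence starting with \<open>a, b\<close>, and
\<open>K\<^sub>n a b = F\<^sub>n a b - G\<^sub>n\<^sub>-\<^sub>1 b\<close> for what the entry \<open>a\<close> is worth. With \<open>\<Phi>\<^sub>n a b\<close> the \<open>\<mu>\<close>-integral
of \<open>K\<^sub>n a d\<close> over \<open>d < b\<close>, averaging over the second term gives
\<open>G\<^sub>n\<^sub>+\<^sub>1 c = (\<integral> G\<^sub>n) + \<Phi>\<^sub>n\<^sub>+\<^sub>1 c c\<close>.

The entry \<open>a\<close> matters only if a pattern starts there. In that case the payoff changes from what
the remaining sequence would have brought to \<open>1\<close> or \<open>-1\<close>, and that remaining sequence may be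
shortened by one or two further entries, since no pattern starts at an ascent. Hence, for \<open>b \<le> a\<close>,
\<open>\<Phi>\<^sub>n\<^sub>+\<^sub>1 a b\<close> is minus the double integral over \<open>d < b\<close> and \<open>c > a\<close> of \<open>\<Phi>\<^sub>n\<^sub>-\<^sub>1 c d + L d - R c\<close>,
where \<open>L d\<close> is the integral of \<open>1 + G\<^sub>n\<^sub>-\<^sub>2\<close> below \<open>d\<close> and \<open>R c\<close> the integral of \<open>1 - G\<^sub>n\<^sub>-\<^sub>2\<close>
above \<open>c\<close>. The map \<open>(c, d) \<mapsto> (-d, -c)\<close> exchanges the two integration conditions, and it changes
the sign of the integrand if \<open>G\<close> is odd, which makes \<open>L (-c) = R c\<close>, and \<open>\<Phi> (-d) (-c) = - \<Phi> c d\<close>.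
So both properties propagate from smaller to larger \<open>n\<close> (lemma \<open>reflection\<close>). An odd \<open>G\<^sub>n\<close> has
integral \<open>0\<close>, hence the expected payoff vanishes for every \<open>n\<close>, and in the limit the two patterns
are equally likely to come first. As \<open>2134\<close> occurs almost surely (\<open>AE_occurrence\<close>), both
probabilities are \<open>1/2\<close>.\<close>

section \<open>The game on a fixed sequence\<close>

definition starts_2134 :: "(nat \<Rightarrow> real) \<Rightarrow> bool" where
  "starts_2134 x \<longleftrightarrow> x 1 < x 0 \<and> x 0 < x 2 \<and> x 2 < x 3"

definition starts_3241 :: "(nat \<Rightarrow> real) \<Rightarrow> bool" where
  "starts_3241 x \<longleftrightarrow> x 3 < x 1 \<and> x 1 < x 0 \<and> x 0 < x 2"

fun payoff :: "nat \<Rightarrow> (nat \<Rightarrow> real) \<Rightarrow> real" where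
  "payoff 0 x = 0"
| "payoff (Suc n) x =
    (if starts_2134 x then 1 else if starts_3241 x then - 1 else payoff n (\<lambda>i. x (Suc i)))"

lemma abs_payoff_le: "\<bar>payoff n x\<bar> \<le> 1"
  by (induction n arbitrary: x) auto

text \<open>Both patterns start with a descent, so a leading ascent only uses up one of the \<open>n\<close>
positions. For \<open>n = 0\<close> the truncated difference is harmless: then both payoffs are \<open>0\<close>.\<close>

lemma payoff_ascent:
  assumes "a \<le> b"
  shows "payoff n (case_nat a (case_nat b x)) = payoff (n - 1) (case_nat b x)"
  using assms by (cases n) (auto simp: starts_2134_def starts_3241_def)

text \<open>Prepending \<open>a\<close> changes the payoff only if a pattern starts at \<open>a\<close>. The payoff that is
replaced then comes from \<open>b < c < d\<close> or from \<open>d < b < c\<close>, where the leading ascents can be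
dropped: two of them in the first case, one in the second. Taking expectations will give the
recursion for \<open>gain\<close>.\<close>

lemma payoff_descent_diff:
  assumes "b < a"
  shows "payoff (Suc n) (case_nat a (case_nat b (case_nat c (case_nat d x))))
       - payoff n (case_nat b (case_nat c (case_nat d x)))
     = of_bool (a < c) * (of_bool (c < d) * (1 - payoff (n - 2) (case_nat d x))
                         - of_bool (d < b) * (1 + payoff (n - 1) (case_nat c (case_nat d x))))"
proof -
  have 2: "payoff n (case_nat b (case_nat c y)) = payoff (n - 1) (case_nat c y)" if "a < c" for y
    using that assms by (simp add: payoff_ascent)
  have 3: "payoff (n - 1) (case_nat c (case_nat d x)) = payoff (n - 2) (case_nat d x)" if "c < d"
    using that by (simp add: payoff_ascent numeral_2_eq_2)
  show ?thesis
    using assms 2 3 by (auto simp: starts_2134_def starts_3241_def numeral_2_eq_2 numeral_3_eq_3)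
qed

definition precedes ::
  "((nat \<Rightarrow> real) \<Rightarrow> bool) \<Rightarrow> ((nat \<Rightarrow> real) \<Rightarrow> bool) \<Rightarrow> (nat \<Rightarrow> real) \<Rightarrow> bool" where
  "precedes P Q x \<longleftrightarrow> (\<exists>i. P (\<lambda>k. x (i + k)) \<and> (\<forall>j\<le>i. \<not> Q (\<lambda>k. x (j + k))))"

lemma precedes_asym: "precedes P Q x \<Longrightarrow> \<not> precedes Q P x"
  unfolding precedes_def by (meson nle_le)

lemma starts_disjoint: "starts_2134 x \<Longrightarrow> \<not> starts_3241 x"
  by (auto simp: starts_2134_def starts_3241_def)

lemma first_occurrence_cases:
  obtains (never) "\<And>i. \<not> starts_2134 (\<lambda>k. x (i + k)) \<and> \<not> starts_3241 (\<lambda>k. x (i + k))"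
  | (hit) i where "starts_2134 (\<lambda>k. x (i + k)) \<or> starts_3241 (\<lambda>k. x (i + k))"
      "\<And>j. j < i \<Longrightarrow> \<not> starts_2134 (\<lambda>k. x (j + k)) \<and> \<not> starts_3241 (\<lambda>k. x (j + k))"
proof (cases "\<exists>i. starts_2134 (\<lambda>k. x (i + k)) \<or> starts_3241 (\<lambda>k. x (i + k))")
  case True
  define Q where "Q i \<longleftrightarrow> starts_2134 (\<lambda>k. x (i + k)) \<or> starts_3241 (\<lambda>k. x (i + k))" for i
  obtain i where "Q i" "\<And>j. j < i \<Longrightarrow> \<not> Q j"
    using True exists_least_iff[of Q] by (auto simp: Q_def)
  then show thesis
    unfolding Q_def de_Morgan_disj by (rule hit)
next
  case False
  then show thesis
    by (intro never) simp
qed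

lemma precedes_at_first:
  assumes "P (\<lambda>k. x (i + k))" "\<not> Q (\<lambda>k. x (i + k))" "\<And>j. j < i \<Longrightarrow> \<not> Q (\<lambda>k. x (j + k))"
  shows "precedes P Q x"
  unfolding precedes_def
proof (intro exI conjI allI impI)
  show "P (\<lambda>k. x (i + k))" by fact
  fix j assume "j \<le> i"
  then show "\<not> Q (\<lambda>k. x (j + k))"
    using assms(2,3) by (cases "j = i") auto
qed

text \<open>At the first position where one of the patterns occurs, it decides the game: the other
cannot occur at the same position.\<close>

lemma precedes_of_first_occurrence:
  assumes "starts_2134 (\<lambda>k. x (i + k)) \<or> starts_3241 (\<lambda>k. x (i + k))"
    and "\<And>j. j < i \<Longrightarrow> \<not> starts_2134 (\<lambda>k. x (j + k)) \<and> \<not> starts_3241 (\<lambda>k. x (j + k))"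
  shows "precedes starts_2134 starts_3241 x \<longleftrightarrow> starts_2134 (\<lambda>k. x (i + k))"
    and "precedes starts_3241 starts_2134 x \<longleftrightarrow> \<not> starts_2134 (\<lambda>k. x (i + k))"
proof -
  have 1: "precedes starts_2134 starts_3241 x" if "starts_2134 (\<lambda>k. x (i + k))"
    using that starts_disjoint[OF that] assms(2) by (intro precedes_at_first[where i = i]) simp_all
  have 2: "precedes starts_3241 starts_2134 x" if "\<not> starts_2134 (\<lambda>k. x (i + k))"
    using that assms by (intro precedes_at_first[where i = i]) simp_all
  show "precedes starts_2134 starts_3241 x \<longleftrightarrow> starts_2134 (\<lambda>k. x (i + k))"
    and "precedes starts_3241 starts_2134 x \<longleftrightarrow> \<not> starts_2134 (\<lambda>k. x (i + k))"
    using 1 2 precedes_asym[of starts_2134 starts_3241 x]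
      precedes_asym[of starts_3241 starts_2134 x] by argo+
qed

lemma occurrence_imp_precedes:
  assumes "starts_2134 (\<lambda>k. x (i + k))"
  shows "precedes starts_2134 starts_3241 x \<or> precedes starts_3241 starts_2134 x"
proof (cases x rule: first_occurrence_cases)
  case never
  then show ?thesis
    using assms by simp
next
  case (hit i)
  then show ?thesis
    by (simp add: precedes_of_first_occurrence[OF hit])
qed

lemma payoff_skip:
  assumes "\<And>j. j < m \<Longrightarrow> \<not> starts_2134 (\<lambda>k. x (j + k)) \<and> \<not> starts_3241 (\<lambda>k. x (j + k))"
  shows "payoff (m + n) x = payoff n (\<lambda>k. x (m + k))"
  using assms
proof (induction m arbitrary: x)
  case (Suc m)
  have "payoff (m + n) (\<lambda>i. x (Suc i)) = payoff n (\<lambda>k. x (Suc (m + k)))"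
    using Suc.prems[of "Suc j" for j] by (intro Suc.IH) simp
  then show ?case
    using Suc.prems[of 0] by simp
qed simp

lemma payoff_tendsto:
  "(\<lambda>n. payoff n x) \<longlonglongrightarrow>
     of_bool (precedes starts_2134 starts_3241 x) - of_bool (precedes starts_3241 starts_2134 x)"
proof (cases x rule: first_occurrence_cases)
  case never
  have "payoff (n + 0) x = payoff 0 (\<lambda>k. x (n + k))" for n
    by (rule payoff_skip) (rule never)
  then have "payoff n x = 0" for n
    by simp
  moreover have "\<not> precedes starts_2134 starts_3241 x" "\<not> precedes starts_3241 starts_2134 x"
    using never unfolding precedes_def by blast+
  ultimately show ?thesis
    by simp
next
  case (hit i)
  let ?y = "\<lambda>k. x (i + k)"
  have "payoff n x = (if starts_2134 ?y then 1 else - 1)" if "Suc i \<le> n" for n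
  proof -
    have "n = i + Suc (n - Suc i)"
      using that by simp
    then show ?thesis
      using payoff_skip[OF hit(2), of i "Suc (n - Suc i)"] hit(1) by auto
  qed
  then have "(\<lambda>n. payoff n x) \<longlonglongrightarrow> (if starts_2134 ?y then 1 else - 1)"
    by (intro tendsto_eventually eventually_sequentiallyI)
  then show ?thesis
    by (cases "starts_2134 ?y") (simp_all add: precedes_of_first_occurrence[OF hit])
qed

lemma (in prob_space) abs_expectation_le:
  fixes f :: "'a \<Rightarrow> real"
  assumes "\<And>x. \<bar>f x\<bar> \<le> B"
  shows "\<bar>expectation f\<bar> \<le> B"
proof (cases "integrable M f")
  case True
  have "\<bar>expectation f\<bar> \<le> expectation (\<lambda>x. \<bar>f x\<bar>)"
    by (rule integral_abs_bound)
  also have "\<dots> \<le> B"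
    using True assms by (intro integral_le_const) auto
  finally show ?thesis .
next
  case False
  then show ?thesis
    using assms[of undefined] by (simp add: not_integrable_integral_eq)
qed

section \<open>Independent terms with a symmetric distribution\<close>

locale symmetric_sequence = sequence_space M for M :: "real measure" +
  assumes sets_M [measurable_cong, simp]: "sets M = sets borel"
    and symmetric: "distr M borel uminus = M"
begin

lemma space_M [simp]: "space M = UNIV"
  using sets_eq_imp_space_eq[OF sets_M] by simp

lemma space_S [simp]: "space S = UNIV"
  by (simp add: space_PiM PiE_def)

lemma coordinate_measurable: "(\<lambda>x. x i) \<in> borel_measurable S"
  by measurable

lemma shift_measurable: "(\<lambda>x i. x (i + k)) \<in> measurable S S"
  by (rule measurable_PiM_single') auto

lemma starts_measurable [measurable]:
  "Measurable.pred S starts_2134" "Measurable.pred S starts_3241"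
  using coordinate_measurable unfolding starts_2134_def starts_3241_def by measurable

lemma payoff_measurable [measurable]: "payoff n \<in> borel_measurable S"
proof (induction n)
  case 0
  show ?case by simp
next
  case (Suc n)
  have "(\<lambda>x i. x (Suc i)) \<in> measurable S S"
    using shift_measurable[of 1] by simp
  from measurable_compose[OF this Suc]
  have [measurable]: "(\<lambda>x. payoff n (\<lambda>i. x (Suc i))) \<in> borel_measurable S" .
  have "(\<lambda>x. if starts_2134 x then 1 else if starts_3241 x then - 1
              else payoff n (\<lambda>i. x (Suc i))) \<in> borel_measurable S"
    by measurable
  then show ?case by (subst measurable_cong) auto
qed

lemma starts_shift_measurable [measurable]:
  "Measurable.pred S (\<lambda>x. starts_2134 (\<lambda>k. x (i + k)))"
  "Measurable.pred S (\<lambda>x. starts_3241 (\<lambda>k. x (i + k)))"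
  using coordinate_measurable unfolding starts_2134_def starts_3241_def by measurable

lemma precedes_measurable [measurable]:
  "Measurable.pred S (precedes starts_2134 starts_3241)"
  "Measurable.pred S (precedes starts_3241 starts_2134)"
  unfolding precedes_def[abs_def] by measurable

lemma Collect_in_sets_S: "Measurable.pred S Q \<Longrightarrow> {x. Q x} \<in> sets S"
  by (simp only: pred_def space_S UNIV_I simp_thms)

lemma integral_reflect:
  fixes f :: "real \<Rightarrow> real"
  assumes [measurable]: "f \<in> borel_measurable borel"
  shows "(\<integral>x. f (- x) \<partial>M) = (\<integral>x. f x \<partial>M)"
proof -
  have "(\<integral>x. f x \<partial>M) = (\<integral>x. f x \<partial>distr M borel uminus)" by (simp add: symmetric)
  also have "\<dots> = (\<integral>x. f (- x) \<partial>M)" by (rule integral_distr) auto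
  finally show ?thesis by simp
qed

text \<open>Revealing the terms one at a time: the shifted sequence is independent of the first term and
has the same distribution as the whole sequence.\<close>

lemma integral_first_coordinate:
  fixes f :: "(nat \<Rightarrow> real) \<Rightarrow> real"
  assumes [measurable]: "f \<in> borel_measurable S" and "\<And>x. \<bar>f x\<bar> \<le> B"
  shows "(\<integral>x. f x \<partial>S) = (\<integral>c. (\<integral>x. f (case_nat c x) \<partial>S) \<partial>M)"
proof -
  interpret pair: pair_prob_space M S ..
  have "(\<integral>x. f x \<partial>S) = (\<integral>x. f x \<partial>distr (M \<Otimes>\<^sub>M S) S (\<lambda>(s, \<omega>). case_nat s \<omega>))"
    by (simp add: PiM_iter)
  also have "\<dots> = (\<integral>p. f (case_nat (fst p) (snd p)) \<partial>(M \<Otimes>\<^sub>M S))"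
    by (subst integral_distr) (auto simp: case_prod_beta)
  also have "\<dots> = (\<integral>c. (\<integral>x. f (case_nat c x) \<partial>S) \<partial>M)"
    by (subst pair.integral_fst'[symmetric])
       (auto intro!: pair.P.integrable_const_bound[where B = B] assms)
  finally show ?thesis .
qed

section \<open>The antisymmetry of the expected payoff\<close>

text \<open>The functions \<open>G\<^sub>n\<close>, \<open>F\<^sub>n\<close>, \<open>K\<^sub>n\<close> and \<open>\<Phi>\<^sub>n\<close> of the introduction are \<open>mean1\<close>, \<open>mean2\<close>, \<open>gain\<close>
and \<open>gain_below\<close>. The two weights compare ending the game at \<open>d\<close> with continuing it from \<open>d\<close>:
\<open>weight_above\<close> integrates the advantage of completing \<open>2134\<close> with \<open>d\<close>, \<open>weight_below\<close> the loss
from completing \<open>3241\<close> with \<open>d\<close>.\<close>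

definition mean1 :: "nat \<Rightarrow> real \<Rightarrow> real" where
  "mean1 n c = (\<integral>x. payoff n (case_nat c x) \<partial>S)"

definition mean2 :: "nat \<Rightarrow> real \<Rightarrow> real \<Rightarrow> real" where
  "mean2 n a b = (\<integral>x. payoff n (case_nat a (case_nat b x)) \<partial>S)"

definition gain :: "nat \<Rightarrow> real \<Rightarrow> real \<Rightarrow> real" where
  "gain n a b = mean2 n a b - mean1 (n - 1) b"

definition gain_below :: "nat \<Rightarrow> real \<Rightarrow> real \<Rightarrow> real" where
  "gain_below n a b = (\<integral>d. of_bool (d < b) * gain n a d \<partial>M)"

definition weight_below :: "nat \<Rightarrow> real \<Rightarrow> real" where
  "weight_below n b = (\<integral>d. of_bool (d < b) * (1 + mean1 n d) \<partial>M)"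

definition weight_above :: "nat \<Rightarrow> real \<Rightarrow> real" where
  "weight_above n c = (\<integral>d. of_bool (c < d) * (1 - mean1 n d) \<partial>M)"

lemma mean1_measurable [measurable]: "mean1 n \<in> borel_measurable borel"
  unfolding mean1_def[abs_def] by measurable

lemma mean2_measurable [measurable (raw)]:
  assumes [measurable]: "f \<in> borel_measurable N" "g \<in> borel_measurable N"
  shows "(\<lambda>w. mean2 n (f w) (g w)) \<in> borel_measurable N"
  unfolding mean2_def by measurable

lemma gain_measurable [measurable (raw)]:
  assumes [measurable]: "f \<in> borel_measurable N" "g \<in> borel_measurable N"
  shows "(\<lambda>w. gain n (f w) (g w)) \<in> borel_measurable N"
  unfolding gain_def by measurable

lemma gain_below_measurable [measurable (raw)]:
  assumes [measurable]: "f \<in> borel_measurable N" "g \<in> borel_measurable N"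
  shows "(\<lambda>w. gain_below n (f w) (g w)) \<in> borel_measurable N"
  unfolding gain_below_def by measurable

lemma weight_measurable [measurable]:
  "weight_below n \<in> borel_measurable borel" "weight_above n \<in> borel_measurable borel"
  unfolding weight_below_def[abs_def] weight_above_def[abs_def] by measurable

lemma abs_mean1_le: "\<bar>mean1 n c\<bar> \<le> 1"
  unfolding mean1_def by (intro P.abs_expectation_le abs_payoff_le)

lemma abs_mean2_le: "\<bar>mean2 n a b\<bar> \<le> 1"
  unfolding mean2_def by (intro P.abs_expectation_le abs_payoff_le)

lemma abs_gain_le: "\<bar>gain n a b\<bar> \<le> 2"
  using abs_mean1_le[of "n - 1" b] abs_mean2_le[of n a b] unfolding gain_def by linarith

lemma abs_gain_below_le: "\<bar>gain_below n a b\<bar> \<le> 2"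
  unfolding gain_below_def using abs_gain_le by (intro M.abs_expectation_le) auto

lemma abs_weight_le: "\<bar>weight_below n b\<bar> \<le> 2" "\<bar>weight_above n b\<bar> \<le> 2"
proof -
  have "\<bar>1 + mean1 n d\<bar> \<le> 2" "\<bar>1 - mean1 n d\<bar> \<le> 2" for d
    using abs_mean1_le[of n d] by linarith+
  then show "\<bar>weight_below n b\<bar> \<le> 2" "\<bar>weight_above n b\<bar> \<le> 2"
    unfolding weight_below_def weight_above_def by (intro M.abs_expectation_le; simp)+
qed

text \<open>If the second term \<open>d\<close> is at least \<open>c\<close>, no pattern starts at \<open>c\<close> and the game continues from
\<open>d\<close>; if it is smaller, there is the additional term \<open>gain\<close>, which \<open>gain_below\<close> collects.\<close>

lemma mean1_Suc: "mean1 (Suc n) c = (\<integral>d. mean1 n d \<partial>M) + gain_below (Suc n) c c"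
proof -
  have "mean1 (Suc n) c = (\<integral>d. mean2 (Suc n) c d \<partial>M)"
    unfolding mean1_def mean2_def
    by (rule integral_first_coordinate[where B = 1]) (simp_all add: abs_payoff_le del: payoff.simps)
  also have "\<dots> = (\<integral>d. mean1 n d + of_bool (d < c) * gain (Suc n) c d \<partial>M)"
  proof (rule Bochner_Integration.integral_cong[OF refl])
    fix d
    have "mean2 (Suc n) c d = mean1 n d" if "c \<le> d"
      using that by (simp only: mean2_def mean1_def payoff_ascent) simp
    then show "mean2 (Suc n) c d = mean1 n d + of_bool (d < c) * gain (Suc n) c d"
      by (auto simp: gain_def)
  qed
  also have "\<dots> = (\<integral>d. mean1 n d \<partial>M) + gain_below (Suc n) c c"
    unfolding gain_below_def
    by (intro Bochner_Integration.integral_add M.integrable_const_bound[where B = 2] AE_I2)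
       (auto intro: order_trans[OF abs_mean1_le] abs_gain_le)
  finally show ?thesis .
qed

text \<open>If a sequence starts with \<open>a, b, c\<close> and \<open>b < a < c\<close>, then \<open>flow\<close> is the expected loss from
having prepended \<open>a\<close> to \<open>b, c\<close>. That it does not depend on \<open>a\<close> is what makes the recursion for
\<open>gain_below\<close> a double integral.\<close>

definition flow :: "nat \<Rightarrow> real \<Rightarrow> real \<Rightarrow> real" where
  "flow n c b = gain_below n c b + weight_below (n - 1) b - weight_above (n - 1) c"

lemma flow_measurable [measurable (raw)]:
  assumes [measurable]: "f \<in> borel_measurable N" "g \<in> borel_measurable N"
  shows "(\<lambda>w. flow n (f w) (g w)) \<in> borel_measurable N"
  unfolding flow_def by measurable

lemma abs_flow_le: "\<bar>flow n c b\<bar> \<le> 6"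
  using abs_gain_below_le[of n c b] abs_weight_le(1)[of "n - 1" b] abs_weight_le(2)[of "n - 1" c]
  unfolding flow_def by linarith

text \<open>Integrating \<open>payoff_descent_diff\<close> over the third and fourth term \<open>c\<close> and \<open>d\<close>, and over the
rest of the sequence.\<close>

lemma gain_Suc:
  assumes "b < a"
  shows "gain (Suc n) a b = - (\<integral>c. of_bool (a < c) * flow (n - 1) c b \<partial>M)"
proof -
  define D where "D x = payoff (Suc n) (case_nat a (case_nat b x)) - payoff n (case_nat b x)" for x
  have D_meas [measurable]: "D \<in> borel_measurable S"
    unfolding D_def by measurable
  have D_le: "\<bar>D x\<bar> \<le> 2" for x
    using abs_payoff_le[of "Suc n" "case_nat a (case_nat b x)"]
      abs_payoff_le[of n "case_nat b x"] unfolding D_def by linarith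
  have inner: "(\<integral>x. D (case_nat c (case_nat d x)) \<partial>S) =
      of_bool (a < c) * (of_bool (c < d) * (1 - mean1 (n - 2) d)
        - of_bool (d < b) * (1 + mean2 (n - 1) c d))" for c d
  proof -
    have "integrable S (\<lambda>x. payoff k (case_nat d x))"
      "integrable S (\<lambda>x. payoff k (case_nat c (case_nat d x)))" for k
      by (intro P.integrable_const_bound[where B = 1] AE_I2; simp add: abs_payoff_le)+
    then show ?thesis
      unfolding D_def payoff_descent_diff[OF assms] mean1_def mean2_def
      by (simp add: P.prob_space[unfolded space_S])
  qed
  have middle: "(\<integral>d. (\<integral>x. D (case_nat c (case_nat d x)) \<partial>S) \<partial>M)
      = - (of_bool (a < c) * flow (n - 1) c b)" for c
  proof -
    \<comment> \<open>Replacing \<open>F\<close> by \<open>G + K\<close> brings both weights to the same index.\<close>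
    have m2: "mean2 (n - 1) c d = mean1 (n - 2) d + gain (n - 1) c d" for d
      by (simp add: gain_def numeral_2_eq_2)
    have le: "\<bar>1 + mean1 k d\<bar> \<le> 2" "\<bar>1 - mean1 k d\<bar> \<le> 2" for k d
      using abs_mean1_le[of k d] by linarith+
    have int: "integrable M (\<lambda>d. of_bool (c < d) * (1 - mean1 (n - 2) d))"
      "integrable M (\<lambda>d. of_bool (d < b) * (1 + mean1 (n - 2) d))"
      "integrable M (\<lambda>d. of_bool (d < b) * gain (n - 1) c d)"
      by (intro M.integrable_const_bound[where B = 2] AE_I2; simp add: le abs_gain_le)+
    have "(\<integral>d. (\<integral>x. D (case_nat c (case_nat d x)) \<partial>S) \<partial>M) =
        (\<integral>d. of_bool (a < c) * (of_bool (c < d) * (1 - mean1 (n - 2) d)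
          - of_bool (d < b) * (1 + mean1 (n - 2) d) - of_bool (d < b) * gain (n - 1) c d) \<partial>M)"
      unfolding inner m2 by (simp add: algebra_simps)
    also have "\<dots> = of_bool (a < c) * (weight_above (n - 2) c - weight_below (n - 2) b
        - gain_below (n - 1) c b)"
      unfolding weight_above_def weight_below_def gain_below_def using int by simp
    finally show ?thesis
      by (simp add: flow_def numeral_2_eq_2)
  qed
  have "gain (Suc n) a b = (\<integral>x. D x \<partial>S)"
    unfolding D_def gain_def mean1_def mean2_def
    by (subst Bochner_Integration.integral_diff)
       (auto intro!: P.integrable_const_bound[where B = 1] simp: abs_payoff_le simp del: payoff.simps)
  also have "\<dots> = (\<integral>c. (\<integral>x. D (case_nat c x) \<partial>S) \<partial>M)"
    by (rule integral_first_coordinate[OF D_meas D_le])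
  also have "\<dots> = (\<integral>c. (\<integral>d. (\<integral>x. D (case_nat c (case_nat d x)) \<partial>S) \<partial>M) \<partial>M)"
    by (intro Bochner_Integration.integral_cong refl integral_first_coordinate[OF _ D_le]) simp
  finally show ?thesis
    unfolding middle by simp
qed

lemma gain_below_Suc:
  assumes "b \<le> a"
  shows "gain_below (Suc n) a b
    = - (\<integral>d. (\<integral>c. of_bool (d < b \<and> a < c) * flow (n - 1) c d \<partial>M) \<partial>M)"
proof -
  have "of_bool (d < b) * gain (Suc n) a d
      = - (\<integral>c. of_bool (d < b \<and> a < c) * flow (n - 1) c d \<partial>M)" for d
    using assms by (auto simp: gain_Suc)
  then show ?thesis
    by (simp add: gain_below_def)
qed

lemma weight_below_reflect:
  assumes "\<And>x. mean1 n (- x) = - mean1 n x"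
  shows "weight_below n (- c) = weight_above n c"
proof -
  have "weight_below n (- c) = (\<integral>d. of_bool (- d < - c) * (1 + mean1 n (- d)) \<partial>M)"
    unfolding weight_below_def by (rule integral_reflect[symmetric]) measurable
  then show ?thesis
    by (simp add: assms weight_above_def)
qed

text \<open>Negating both variables turns the conditions \<open>d < - a\<close> and \<open>- b < c\<close> into \<open>a < d\<close> and
\<open>c < b\<close>, so that \<open>c\<close> and \<open>d\<close> have exchanged their roles; Fubini's theorem restores the order of
integration.\<close>

lemma gain_below_reflect_Suc:
  assumes flow: "\<And>c d. d \<le> c \<Longrightarrow> flow (n - 1) (- d) (- c) = - flow (n - 1) c d"
    and "b \<le> a"
  shows "gain_below (Suc n) (- b) (- a) = - gain_below (Suc n) a b"
proof -
  interpret MM: pair_prob_space M M ..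
  define f where "f d c = of_bool (d < b \<and> a < c) * flow (n - 1) c d" for c d
  have [measurable]: "(\<lambda>p. f (g p) (h p)) \<in> borel_measurable N"
    if [measurable]: "g \<in> borel_measurable N" "h \<in> borel_measurable N" for N g h
    unfolding f_def by measurable
  have "gain_below (Suc n) (- b) (- a)
      = - (\<integral>d. (\<integral>c. of_bool (d < - a \<and> - b < c) * flow (n - 1) c d \<partial>M) \<partial>M)"
    using \<open>b \<le> a\<close> by (simp add: gain_below_Suc)
  also have "\<dots> = - (\<integral>d. (\<integral>c. of_bool (- d < - a \<and> - b < - c) * flow (n - 1) (- c) (- d) \<partial>M) \<partial>M)"
    by (subst integral_reflect[symmetric], measurable, subst integral_reflect[symmetric], measurable)
  also have "\<dots> = - (\<integral>d. (\<integral>c. - f c d \<partial>M) \<partial>M)"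
  proof -
    have "of_bool (- d < - a \<and> - b < - c) * flow (n - 1) (- c) (- d) = - f c d" for c d
      using \<open>b \<le> a\<close> flow[of c d] by (auto simp: f_def)
    then show ?thesis by simp
  qed
  also have "\<dots> = (\<integral>d. (\<integral>c. f c d \<partial>M) \<partial>M)"
    by simp
  also have "\<dots> = (\<integral>c. (\<integral>d. f c d \<partial>M) \<partial>M)"
    by (rule MM.Fubini_integral)
       (auto intro!: MM.P.integrable_const_bound[where B = 6] simp: f_def case_prod_beta abs_flow_le)
  also have "\<dots> = - gain_below (Suc n) a b"
    using \<open>b \<le> a\<close> by (simp add: gain_below_Suc f_def)
  finally show ?thesis .
qed

lemma integral_mean1_odd:
  assumes "\<And>x. mean1 n (- x) = - mean1 n x"
  shows "(\<integral>d. mean1 n d \<partial>M) = 0"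
  using integral_reflect[of "mean1 n"] by (simp add: assms)

text \<open>The recursions for \<open>mean1\<close> and \<open>gain_below\<close> at \<open>Suc k\<close> only refer to the indices \<open>k\<close>,
\<open>k - 1\<close> and \<open>k - 2\<close>, and each of them respects the reflection. The restriction \<open>b \<le> a\<close> is
inherited from the recursion for \<open>gain\<close>, which only describes descents.\<close>

lemma reflection:
  "mean1 n (- c) = - mean1 n c \<and>
   (b \<le> a \<longrightarrow> gain_below n (- b) (- a) = - gain_below n a b)"
proof (induction n arbitrary: a b c rule: less_induct)
  case (less n)
  show ?case
  proof (cases n)
    case 0
    then show ?thesis
      by (simp add: mean1_def gain_below_def gain_def mean2_def)
  next
    case (Suc k)
    have odd: "mean1 m (- x) = - mean1 m x" if "m \<le> k" for m x
      using less[of m] that Suc by simp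
    have "flow (k - 1) (- d) (- c) = - flow (k - 1) c d" if "d \<le> c" for c d
    proof -
      have "gain_below (k - 1) (- d) (- c) = - gain_below (k - 1) c d"
        using less[of "k - 1" _ d c] that Suc by auto
      moreover have "weight_below (k - 1 - 1) (- c) = weight_above (k - 1 - 1) c" for c
        by (intro weight_below_reflect odd) simp
      from this[of c] this[of "- d"]
      have "weight_below (k - 1 - 1) (- c) = weight_above (k - 1 - 1) c"
        "weight_above (k - 1 - 1) (- d) = weight_below (k - 1 - 1) d" by simp_all
      ultimately show ?thesis
        by (simp add: flow_def)
    qed
    note below = gain_below_reflect_Suc[of k, OF this]
    have "mean1 (Suc k) (- c) = - mean1 (Suc k) c"
      using below[of c c] by (simp add: mean1_Suc integral_mean1_odd odd)
    with below Suc show ?thesis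
      by simp
  qed
qed

lemma expectation_payoff: "(\<integral>x. payoff n x \<partial>S) = 0"
proof -
  have "(\<integral>x. payoff n x \<partial>S) = (\<integral>c. mean1 n c \<partial>M)"
    unfolding mean1_def using abs_payoff_le by (intro integral_first_coordinate[where B = 1]) auto
  then show ?thesis
    by (simp add: integral_mean1_odd reflection)
qed

section \<open>The two patterns are equally likely to come first\<close>

lemma prob_precedes_swap:
  "P.prob {x. precedes starts_2134 starts_3241 x} = P.prob {x. precedes starts_3241 starts_2134 x}"
proof -
  let ?f = "\<lambda>x. of_bool (precedes starts_2134 starts_3241 x) - of_bool (precedes starts_3241 starts_2134 x) :: real"
  have "(\<lambda>n. \<integral>x. payoff n x \<partial>S) \<longlonglongrightarrow> (\<integral>x. ?f x \<partial>S)"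
    by (rule integral_dominated_convergence[where w = "\<lambda>_. 1"])
       (auto simp: payoff_tendsto abs_payoff_le)
  then have "(\<integral>x. ?f x \<partial>S) = 0"
    by (simp add: expectation_payoff LIMSEQ_const_iff)
  moreover have "(\<integral>x. ?f x \<partial>S) = (\<integral>x. of_bool (precedes starts_2134 starts_3241 x) \<partial>S)
       - (\<integral>x. of_bool (precedes starts_3241 starts_2134 x) \<partial>S)"
    by (intro Bochner_Integration.integral_diff P.integrable_const_bound[where B = 1]) auto
  moreover have "(\<integral>x. of_bool (Q x) \<partial>S) = P.prob {x. Q x}" for Q
  proof -
    have "of_bool (Q x) = (indicator {x. Q x} x :: real)" for x
      by (simp add: indicator_def)
    then show ?thesis by simp
  qed
  ultimately show ?thesis by simp
qed

text \<open>It suffices to look at the disjoint blocks of four terms. Let \<open>E\<close> be the event that none of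
them has the pattern \<open>2134\<close>. It is the event that the first block fails and the sequence shifted
by four is in \<open>E\<close>, so independence gives \<open>P E = (1 - p) P E\<close> with \<open>p > 0\<close>, which forces \<open>P E = 0\<close>.\<close>

lemma AE_occurrence:
  assumes "0 < P.prob {x. starts_2134 x}"
  shows "AE x in S. \<exists>i. starts_2134 (\<lambda>j. x (i + j))"
proof -
  let ?E = "{x. \<forall>k. \<not> starts_2134 (\<lambda>j. x (4 * k + j))}"
  have E: "?E \<in> sets S" by (rule Collect_in_sets_S) measurable
  have A: "{x. \<not> starts_2134 x} \<in> sets S" by (rule Collect_in_sets_S) measurable
  have "comb_seq 4 x y \<in> ?E \<longleftrightarrow> \<not> starts_2134 x \<and> y \<in> ?E" for x y
  proof -
    have head: "starts_2134 (\<lambda>j. comb_seq 4 x y (4 * 0 + j)) = starts_2134 x"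
      by (simp add: starts_2134_def comb_seq_def)
    have tail: "(\<lambda>j. comb_seq 4 x y (4 * Suc k + j)) = (\<lambda>j. y (4 * k + j))" for k
      by (simp add: comb_seq_def)
    have all_nat: "(\<forall>k. Q k) \<longleftrightarrow> Q 0 \<and> (\<forall>k. Q (Suc k))" for Q :: "nat \<Rightarrow> bool"
      by (metis nat.exhaust)
    show ?thesis
      using all_nat[of "\<lambda>k. \<not> starts_2134 (\<lambda>j. comb_seq 4 x y (4 * k + j))"]
      by (simp only: head tail mem_Collect_eq)
  qed
  then have preimage: "(\<lambda>(x, y). comb_seq 4 x y) -` ?E \<inter> space (S \<Otimes>\<^sub>M S) = {x. \<not> starts_2134 x} \<times> ?E"
    by (auto simp: space_pair_measure)
  interpret SS: pair_prob_space S S ..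
  have "emeasure S ?E = emeasure (distr (S \<Otimes>\<^sub>M S) S (\<lambda>(x, y). comb_seq 4 x y)) ?E"
    by (simp add: PiM_comb_seq)
  also have "\<dots> = emeasure S {x. \<not> starts_2134 x} * emeasure S ?E"
    by (simp only: emeasure_distr[OF measurable_comb_seq E] preimage
        P.emeasure_pair_measure_Times[OF A E])
  finally have "P.prob ?E = P.prob {x. \<not> starts_2134 x} * P.prob ?E"
    by (simp add: P.emeasure_eq_measure flip: ennreal_mult)
  moreover have "P.prob {x. \<not> starts_2134 x} = 1 - P.prob {x. starts_2134 x}"
    using P.prob_neg[of starts_2134] Collect_in_sets_S[OF starts_measurable(1)] by simp
  ultimately have "P.prob ?E = 0"
    using assms by auto
  then have "AE x in S. x \<notin> ?E"
    using E by (simp add: AE_iff_null P.emeasure_eq_measure null_sets_def)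
  then show ?thesis
    by eventually_elim auto
qed

lemma prob_starts_2134_pos:
  assumes "r < s" "s < t"
    and "0 < M.prob {..r}" "0 < M.prob {r<..s}" "0 < M.prob {s<..t}" "0 < M.prob {t<..}"
  shows "0 < P.prob {x. starts_2134 x}"
proof -
  define A where "A = (\<lambda>i::nat. if i = 0 then {r<..s} else if i = 1 then {..r}
                                else if i = 2 then {s<..t} else {t<..})"
  have "0 < (\<Prod>i<4. M.prob (A i))"
    using assms by (intro prod_pos) (auto simp: A_def)
  also have "\<dots> = P.prob (prod_emb UNIV (\<lambda>_. M) {..<4} (Pi\<^sub>E {..<4} A))"
    by (intro measure_PiM_emb[symmetric]) (auto simp: A_def)
  also have "\<dots> \<le> P.prob {x. starts_2134 x}"
  proof (rule P.finite_measure_mono)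
    show "prod_emb UNIV (\<lambda>_. M) {..<4} (Pi\<^sub>E {..<4} A) \<subseteq> {x. starts_2134 x}"
    proof
      fix x assume "x \<in> prod_emb UNIV (\<lambda>_. M) {..<4} (Pi\<^sub>E {..<4} A)"
      then have "x i \<in> A i" if "i < 4" for i
        using that by (auto simp: prod_emb_def PiE_iff)
      from this[of 0] this[of 1] this[of 2] this[of 3] show "x \<in> {x. starts_2134 x}"
        by (auto simp: A_def starts_2134_def)
    qed
  qed (rule Collect_in_sets_S, measurable)
  finally show ?thesis .
qed

lemma prob_precedes_half:
  assumes "0 < P.prob {x. starts_2134 x}"
  shows "P.prob {x. precedes starts_2134 starts_3241 x} = 1 / 2"
    and "P.prob {x. precedes starts_3241 starts_2134 x} = 1 / 2"
proof -
  let ?A = "{x. precedes starts_2134 starts_3241 x}"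
  let ?B = "{x. precedes starts_3241 starts_2134 x}"
  have sets: "?A \<in> sets S" "?B \<in> sets S"
    by (rule Collect_in_sets_S, rule precedes_measurable)+
  have "AE x in S. x \<in> ?A \<union> ?B"
    using AE_occurrence[OF assms] by eventually_elim (auto dest: occurrence_imp_precedes)
  then have "P.prob (?A \<union> ?B) = 1"
    using sets by (subst P.prob_eq_1) auto
  moreover have "P.prob (?A \<union> ?B) = P.prob ?A + P.prob ?B"
    using sets by (rule P.finite_measure_Union) (blast dest: precedes_asym)
  ultimately show "P.prob ?A = 1 / 2" "P.prob ?B = 1 / 2"
    using prob_precedes_swap by linarith+
qed

end

section \<open>Reduction to the centred uniform distribution\<close>

text \<open>The distribution function of the uniform distribution on the interval from \<open>-1/2\<close> to \<open>1/2\<close>.\<close>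

definition centred_uniform_cdf :: "real \<Rightarrow> real" where
  "centred_uniform_cdf t = max 0 (min 1 (t + 1 / 2))"

text \<open>The probability integral transform. A continuous distribution function \<open>F\<close> takes every value
strictly between \<open>0\<close> and \<open>1\<close>. Comparing the event \<open>F \<le> u\<close> with the half-lines that end at points
where \<open>F\<close> takes values close to \<open>u\<close> bounds its probability from both sides; \<open>F\<close> may have flat
pieces, so the preimage need not end at such a point itself.\<close>

lemma (in real_distribution) cdf_distr_cdf:
  assumes "continuous_on UNIV (cdf M)"
  shows "cdf (distr M borel (\<lambda>y. cdf M y - 1 / 2)) = centred_uniform_cdf"
proof
  fix t
  let ?F = "cdf M"
  have [measurable]: "?F \<in> borel_measurable borel"
    using assms by (rule borel_measurable_continuous_onI)
  have attained: "\<exists>y. ?F y = v" if "0 < v" "v < 1" for v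
  proof -
    have "eventually (\<lambda>y. ?F y < v) at_bot"
      using cdf_lim_at_bot \<open>0 < v\<close> by (rule order_tendstoD)
    then obtain p where p: "?F p < v"
      by (auto simp: eventually_at_bot_linorder)
    have "eventually (\<lambda>y. v < ?F y) at_top"
      using cdf_lim_at_top_prob \<open>v < 1\<close> by (rule order_tendstoD)
    then obtain q where q: "v < ?F q"
      by (auto simp: eventually_at_top_linorder)
    have "p \<le> q"
      using p q cdf_nondecreasing[of q p] by linarith
    then show ?thesis
      using IVT'[of ?F p v q] p q continuous_on_subset[OF assms] by auto
  qed
  define m where "m u = prob {y. ?F y \<le> u}" for u
  have m_nonneg: "0 \<le> m u" and m_le_1: "m u \<le> 1" for u
    unfolding m_def by simp_all
  have m_mono: "m u \<le> m v" if "u \<le> v" for u v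
    unfolding m_def using that by (intro finite_measure_mono) auto
  have lower: "v \<le> m v" if "0 < v" "v < 1" for v
  proof -
    obtain y where "?F y = v" using attained \<open>0 < v\<close> \<open>v < 1\<close> by blast
    then have "v = prob {..y}" by (simp add: cdf_def)
    also have "\<dots> \<le> m v"
      unfolding m_def using \<open>?F y = v\<close> by (intro finite_measure_mono) (auto intro: cdf_nondecreasing)
    finally show ?thesis .
  qed
  have upper: "m u \<le> v" if "u < v" "0 < v" "v < 1" for u v
  proof -
    obtain y where "?F y = v" using attained \<open>0 < v\<close> \<open>v < 1\<close> by blast
    have "z \<le> y" if "?F z \<le> u" for z
      using that \<open>u < v\<close> \<open>?F y = v\<close> cdf_nondecreasing[of y z] by linarith
    then have "m u \<le> prob {..y}"
      unfolding m_def by (intro finite_measure_mono) auto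
    then show ?thesis using \<open>?F y = v\<close> by (simp add: cdf_def)
  qed
  have m: "m u = max 0 (min 1 u)" for u
  proof (rule antisym)
    show "m u \<le> max 0 (min 1 u)"
    proof (rule dense_ge)
      fix v assume v: "max 0 (min 1 u) < v"
      show "m u \<le> v"
      proof (cases "v < 1")
        case True
        with v upper[of u v] show ?thesis by auto
      next
        case False
        with m_le_1[of u] show ?thesis by linarith
      qed
    qed
    show "max 0 (min 1 u) \<le> m u"
    proof (rule dense_le)
      fix v assume v: "v < max 0 (min 1 u)"
      show "v \<le> m u"
      proof (cases "0 < v")
        case True
        with v have "v < 1" "v < u" by auto
        with True lower[of v] m_mono[of v u] show ?thesis by auto
      next
        case False
        with m_nonneg[of u] show ?thesis by linarith
      qed
    qed
  qed
  have "cdf (distr M borel (\<lambda>y. ?F y - 1 / 2)) t = measure (distr M borel (\<lambda>y. ?F y - 1 / 2)) {..t}"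
    by (simp only: cdf_def)
  also have "\<dots> = m (t + 1 / 2)"
    unfolding m_def by (subst measure_distr) (auto intro!: arg_cong[where f = prob])
  finally have "cdf (distr M borel (\<lambda>y. ?F y - 1 / 2)) t = m (t + 1 / 2)" .
  then show "cdf (distr M borel (\<lambda>y. ?F y - 1 / 2)) t = centred_uniform_cdf t"
    by (simp add: m centred_uniform_cdf_def)
qed

lemma (in real_distribution) singleton_null_of_cdf:
  assumes "cdf M = centred_uniform_cdf"
  shows "prob {t} = 0"
proof -
  have "isCont centred_uniform_cdf t"
    unfolding centred_uniform_cdf_def by (intro continuous_intros)
  then show ?thesis
    using isCont_cdf[of t] assms by simp
qed

lemma (in real_distribution) distr_uminus_of_cdf:
  assumes "cdf M = centred_uniform_cdf"
  shows "distr M borel uminus = M"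
proof (rule cdf_unique)
  show "real_distribution (distr M borel uminus)" by simp
  show "cdf (distr M borel uminus) = cdf M"
  proof
    fix t
    have "cdf (distr M borel uminus) t = prob {- t..}"
      unfolding cdf_def by (subst measure_distr) (auto intro!: arg_cong[where f = prob])
    also have "\<dots> = prob (space M - ({..- t} - {- t}))"
      by (intro arg_cong[where f = prob]) auto
    also have "\<dots> = 1 - prob ({..- t} - {- t})"
      by (rule prob_compl) simp
    also have "prob ({..- t} - {- t}) = cdf M (- t) - prob {- t}"
      unfolding cdf_def by (rule finite_measure_Diff) auto
    finally show "cdf (distr M borel uminus) t = cdf M t"
      by (simp add: assms singleton_null_of_cdf) (simp add: centred_uniform_cdf_def)
  qed
qed (rule real_distribution_axioms)

lemma (in prob_space) AE_distinct_of_indep: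
  fixes U :: "nat \<Rightarrow> 'a \<Rightarrow> real"
  assumes indep: "indep_vars (\<lambda>_. borel) U UNIV"
    and null: "\<And>i t. measure (distr M borel (U i)) {t} = 0"
  shows "AE \<omega> in M. \<forall>i j. i \<noteq> j \<longrightarrow> U i \<omega> \<noteq> U j \<omega>"
proof -
  have rv [measurable]: "random_variable borel (U i)" for i
    using indep by (auto simp: indep_vars_def)
  have "AE \<omega> in M. U i \<omega> \<noteq> U j \<omega>" if "i \<noteq> j" for i j
  proof -
    let ?D = "\<lambda>i. distr M borel (U i)"
    interpret Dj: prob_space "?D j" by (rule prob_space_distr) simp
    interpret pair_sigma_finite "?D i" "?D j"
      by (intro pair_sigma_finite.intro prob_space_imp_sigma_finite prob_space_distr) simp_all
    have "indep_var (Pi\<^sub>M {i} (\<lambda>_. borel)) (\<lambda>\<omega>. restrict (\<lambda>k. U k \<omega>) {i})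
        (Pi\<^sub>M {j} (\<lambda>_. borel)) (\<lambda>\<omega>. restrict (\<lambda>k. U k \<omega>) {j})"
      using that by (intro indep_var_restrict[OF indep]) auto
    from indep_var_compose[OF this, of "\<lambda>f. f i" borel "\<lambda>f. f j" borel]
    have "indep_var borel (U i) borel (U j)"
      by (simp add: comp_def)
    then have joint: "distr M (borel \<Otimes>\<^sub>M borel) (\<lambda>\<omega>. (U i \<omega>, U j \<omega>)) = ?D i \<Otimes>\<^sub>M ?D j"
      by (simp add: indep_var_distribution_eq)
    have "AE p in ?D i \<Otimes>\<^sub>M ?D j. fst p \<noteq> snd p"
    proof (rule AE_pair_measure)
      show "AE x in ?D i. AE y in ?D j. fst (x, y) \<noteq> snd (x, y)"
        using null[of j] by (auto simp: AE_iff_null null_sets_def Dj.emeasure_eq_measure)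
    qed measurable
    then show ?thesis
      unfolding joint[symmetric] by (subst (asm) AE_distr_iff) auto
  qed
  then show ?thesis
    by (auto simp: AE_all_countable intro: AE_I2)
qed

section \<open>From the two patterns to order conditions\<close>

lemma less_card_rank_iff:
  fixes x y :: real
  assumes "finite A" "x \<in> A" "y \<in> A"
  shows "card {z \<in> A. z \<le> x} < card {z \<in> A. z \<le> y} \<longleftrightarrow> x < y"
proof
  assume "x < y"
  then have "{z \<in> A. z \<le> x} \<subseteq> {z \<in> A. z \<le> y}" "y \<in> {z \<in> A. z \<le> y} - {z \<in> A. z \<le> x}"
    using assms by auto
  then show "card {z \<in> A. z \<le> x} < card {z \<in> A. z \<le> y}"
    using assms by (intro psubset_card_mono) auto
next
  assume *: "card {z \<in> A. z \<le> x} < card {z \<in> A. z \<le> y}"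
  show "x < y"
  proof (rule ccontr)
    assume "\<not> x < y"
    with assms have "card {z \<in> A. z \<le> y} \<le> card {z \<in> A. z \<le> x}"
      by (intro card_mono) auto
    with * show False by simp
  qed
qed

lemma st_2134: "st [p, q, r, s] = [2, 1, 3, 4] \<longleftrightarrow> q < p \<and> p < r \<and> r < s"
proof
  assume "st [p, q, r, s] = [2, 1, 3, 4]"
  then show "q < p \<and> p < r \<and> r < s"
    using less_card_rank_iff[of "{p, q, r, s}" q p] less_card_rank_iff[of "{p, q, r, s}" p r]
      less_card_rank_iff[of "{p, q, r, s}" r s]
    by (simp add: st_def)
next
  assume *: "q < p \<and> p < r \<and> r < s"
  then have "{z \<in> {p, q, r, s}. z \<le> p} = {p, q}" "{z \<in> {p, q, r, s}. z \<le> q} = {q}"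
    "{z \<in> {p, q, r, s}. z \<le> r} = {p, q, r}" "{z \<in> {p, q, r, s}. z \<le> s} = {p, q, r, s}"
    by auto
  with * show "st [p, q, r, s] = [2, 1, 3, 4]"
    by (simp add: st_def)
qed

lemma st_3241: "st [p, q, r, s] = [3, 2, 4, 1] \<longleftrightarrow> s < q \<and> q < p \<and> p < r"
proof
  assume "st [p, q, r, s] = [3, 2, 4, 1]"
  then show "s < q \<and> q < p \<and> p < r"
    using less_card_rank_iff[of "{p, q, r, s}" s q] less_card_rank_iff[of "{p, q, r, s}" q p]
      less_card_rank_iff[of "{p, q, r, s}" p r]
    by (simp add: st_def)
next
  assume *: "s < q \<and> q < p \<and> p < r"
  then have "{z \<in> {p, q, r, s}. z \<le> p} = {p, q, s}" "{z \<in> {p, q, r, s}. z \<le> q} = {q, s}"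
    "{z \<in> {p, q, r, s}. z \<le> r} = {p, q, r, s}" "{z \<in> {p, q, r, s}. z \<le> s} = {s}"
    by auto
  with * show "st [p, q, r, s] = [3, 2, 4, 1]"
    by (simp add: st_def)
qed

lemma occurs_at_2134: "occurs_at [2, 1, 3, 4] x i \<longleftrightarrow> starts_2134 (\<lambda>k. x (i + k))"
  and occurs_at_3241: "occurs_at [3, 2, 4, 1] x i \<longleftrightarrow> starts_3241 (\<lambda>k. x (i + k))"
proof -
  have "map x [i..<i + 4] = [x i, x (i + 1), x (i + 2), x (i + 3)]"
    by (simp add: upt_rec eval_nat_numeral)
  moreover have "length [2, 1, 3, 4 :: nat] = 4" "length [3, 2, 4, 1 :: nat] = 4"
    by simp_all
  ultimately show "occurs_at [2, 1, 3, 4] x i \<longleftrightarrow> starts_2134 (\<lambda>k. x (i + k))"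
    "occurs_at [3, 2, 4, 1] x i \<longleftrightarrow> starts_3241 (\<lambda>k. x (i + k))"
    by (simp_all only: occurs_at_def st_2134 st_3241 starts_2134_def starts_3241_def add_0_right)
qed

lemma first_occ_less_iff:
  "first_occ \<sigma> x < first_occ \<tau> x \<longleftrightarrow> (\<exists>i. occurs_at \<sigma> x i \<and> (\<forall>j\<le>i. \<not> occurs_at \<tau> x j))"
proof -
  have "enat i < first_occ \<tau> x \<longleftrightarrow> (\<forall>j\<le>i. \<not> occurs_at \<tau> x j)" for i
  proof -
    have "first_occ \<tau> x \<le> enat i \<longleftrightarrow> first_occ \<tau> x < enat (Suc i)"
      by (cases "first_occ \<tau> x") auto
    also have "\<dots> \<longleftrightarrow> (\<exists>j\<le>i. occurs_at \<tau> x j)"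
      unfolding first_occ_def Inf_less_iff by (auto simp: less_Suc_eq_le)
    finally show ?thesis by (auto simp: not_le[symmetric])
  qed
  then show ?thesis
    unfolding first_occ_def[of \<sigma>] Inf_less_iff by auto
qed

lemma first_occ_less_2134_3241:
  "first_occ [2, 1, 3, 4] x < first_occ [3, 2, 4, 1] x \<longleftrightarrow> precedes starts_2134 starts_3241 x"
  "first_occ [3, 2, 4, 1] x < first_occ [2, 1, 3, 4] x \<longleftrightarrow> precedes starts_3241 starts_2134 x"
  unfolding first_occ_less_iff occurs_at_2134 occurs_at_3241 precedes_def by (rule refl)+

section \<open>The tie\<close>

lemma precedes_order_iso:
  assumes "\<And>i j. x i < x j \<longleftrightarrow> y i < y j"
  shows "precedes starts_2134 starts_3241 x \<longleftrightarrow> precedes starts_2134 starts_3241 y"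
    and "precedes starts_3241 starts_2134 x \<longleftrightarrow> precedes starts_3241 starts_2134 y"
  unfolding precedes_def starts_2134_def starts_3241_def assms by (rule refl)+

lemma precedes_measurable_process:
  assumes [measurable]: "\<And>i. X i \<in> borel_measurable M"
  shows "Measurable.pred M (\<lambda>\<omega>. precedes starts_2134 starts_3241 (\<lambda>i. X i \<omega>))"
    and "Measurable.pred M (\<lambda>\<omega>. precedes starts_3241 starts_2134 (\<lambda>i. X i \<omega>))"
  unfolding precedes_def starts_2134_def starts_3241_def by measurable

lemma (in prob_space) symmetric_sequence_of_indep:
  fixes U :: "nat \<Rightarrow> 'a \<Rightarrow> real"
  assumes indep: "indep_vars (\<lambda>_. borel) U UNIV"
    and cdf: "\<And>i. cdf (distr M borel (U i)) = centred_uniform_cdf"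
  shows "symmetric_sequence (distr M borel (U 0))"
    and "distr M (Pi\<^sub>M UNIV (\<lambda>_. borel)) (\<lambda>\<omega> i. U i \<omega>) = Pi\<^sub>M UNIV (\<lambda>_. distr M borel (U 0))"
proof -
  have rv [measurable]: "random_variable borel (U i)" for i
    using indep by (auto simp: indep_vars_def)
  interpret D: real_distribution "distr M borel (U 0)" by simp
  interpret P: product_prob_space "\<lambda>_. distr M borel (U 0)" "UNIV :: nat set"
    by (intro product_prob_spaceI D.prob_space_axioms)
  show "symmetric_sequence (distr M borel (U 0))"
    by unfold_locales (simp_all add: D.distr_uminus_of_cdf[OF cdf])
  have same: "distr M borel (U i) = distr M borel (U 0)" for i
    by (rule cdf_unique) (simp_all add: cdf)
  have "distr M (Pi\<^sub>M UNIV (\<lambda>_. borel)) (\<lambda>\<omega> i. U i \<omega>) = Pi\<^sub>M UNIV (\<lambda>i. distr M borel (U i))"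
    using indep by (subst (asm) indep_vars_iff_distr_eq_PiM') (simp_all add: restrict_UNIV)
  also have "\<dots> = Pi\<^sub>M UNIV (\<lambda>_. distr M borel (U 0))"
    by (intro PiM_cong refl same)
  finally show "distr M (Pi\<^sub>M UNIV (\<lambda>_. borel)) (\<lambda>\<omega> i. U i \<omega>) = Pi\<^sub>M UNIV (\<lambda>_. distr M borel (U 0))" .
qed

text \<open>The points \<open>-1/4\<close>, \<open>0\<close> and \<open>1/4\<close> cut the line into four pieces of probability \<open>1/4\<close>; putting
one term in each piece, in the right order, shows that \<open>2134\<close> occurs at a given position with
positive probability.\<close>

lemma (in symmetric_sequence) prob_precedes_uniform:
  assumes cdf: "cdf M = centred_uniform_cdf"
  shows "P.prob {x. precedes starts_2134 starts_3241 x} = 1 / 2"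
    and "P.prob {x. precedes starts_3241 starts_2134 x} = 1 / 2"
proof -
  interpret D: real_distribution M
    by unfold_locales simp_all
  have le: "M.prob {..r} = centred_uniform_cdf r" for r
    using cdf by (simp add: cdf_def fun_eq_iff)
  have Ioc: "M.prob {r<..s} = centred_uniform_cdf s - centred_uniform_cdf r" if "r < s" for r s
    using D.cdf_diff_eq[OF that] cdf by simp
  have Ioi: "M.prob {t<..} = 1 - centred_uniform_cdf t" for t
  proof -
    have "M.prob {t<..} = M.prob (space M - {..t})"
      by (intro arg_cong[where f = M.prob]) auto
    also have "\<dots> = 1 - centred_uniform_cdf t"
      by (subst M.prob_compl) (simp_all add: le)
    finally show ?thesis .
  qed
  have "0 < P.prob {x. starts_2134 x}"
    by (rule prob_starts_2134_pos[of "- 1 / 4" 0 "1 / 4"])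
      (simp_all add: le Ioc Ioi centred_uniform_cdf_def)
  from prob_precedes_half[OF this]
  show "P.prob {x. precedes starts_2134 starts_3241 x} = 1 / 2"
    and "P.prob {x. precedes starts_3241 starts_2134 x} = 1 / 2" .
qed

theorem theorem5p3:
  fixes M :: "'a measure" and X :: "nat \<Rightarrow> 'a \<Rightarrow> real"
  assumes "prob_space M"
    and "prob_space.indep_vars M (\<lambda>_. borel) X UNIV"
    and "\<And>i j. distr M borel (X i) = distr M borel (X j)"
    and "\<And>i. continuous_on UNIV (cdf (distr M borel (X i)))"
  shows "tied M X [2, 1, 3, 4] [3, 2, 4, 1]"
proof -
  interpret prob_space M by fact
  let ?\<nu> = "distr M borel (X 0)"
  have rv [measurable]: "random_variable borel (X i)" for i
    using assms(2) by (auto simp: indep_vars_def)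
  interpret X: real_distribution ?\<nu> by simp
  have [measurable]: "cdf ?\<nu> \<in> borel_measurable borel"
    using assms(4) by (rule borel_measurable_continuous_onI)
  define U where "U i \<omega> = cdf ?\<nu> (X i \<omega>) - 1 / 2" for i \<omega>
  have [measurable]: "random_variable borel (U i)" for i
    unfolding U_def by measurable
  have indep: "indep_vars (\<lambda>_. borel) U UNIV"
    unfolding U_def[abs_def] by (rule indep_vars_compose2[OF assms(2)]) measurable
  have cdf_U: "cdf (distr M borel (U i)) = centred_uniform_cdf" for i
  proof -
    have "distr M borel (U i) = distr (distr M borel (X i)) borel (\<lambda>y. cdf ?\<nu> y - 1 / 2)"
      by (subst distr_distr) (auto simp: U_def[abs_def] comp_def)
    also have "distr M borel (X i) = ?\<nu>" by (rule assms(3))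
    finally show ?thesis
      by (simp add: X.cdf_distr_cdf[OF assms(4)])
  qed
  interpret U: symmetric_sequence "distr M borel (U 0)"
    by (rule symmetric_sequence_of_indep(1)[OF indep cdf_U])
  have joint: "distr M (Pi\<^sub>M UNIV (\<lambda>_. borel)) (\<lambda>\<omega> i. U i \<omega>) = U.S"
    by (rule symmetric_sequence_of_indep(2)[OF indep cdf_U])
  have "measure (distr M borel (U i)) {t} = 0" for i t
    by (rule real_distribution.singleton_null_of_cdf) (simp_all add: cdf_U)
  \<comment> \<open>Where the distribution function of the terms is flat, distinct values of \<open>X\<close> give equal
    values of \<open>U\<close>. As the \<open>U i\<close> are almost surely distinct, this happens with probability \<open>0\<close>.\<close>
  from AE_distinct_of_indep[OF indep this]
  have same_order: "AE \<omega> in M. \<forall>i j. X i \<omega> < X j \<omega> \<longleftrightarrow> U i \<omega> < U j \<omega>"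
  proof eventually_elim
    case (elim \<omega>)
    have mono: "U i \<omega> \<le> U j \<omega>" if "X i \<omega> \<le> X j \<omega>" for i j
      using X.cdf_nondecreasing[OF that] by (simp add: U_def)
    show ?case
    proof (intro allI)
      fix i j
      show "X i \<omega> < X j \<omega> \<longleftrightarrow> U i \<omega> < U j \<omega>"
        using elim[rule_format, of i j] mono[of i j] mono[of j i]
        by (cases "i = j"; cases "X i \<omega>" "X j \<omega>" rule: linorder_cases) auto
    qed
  qed
  \<comment> \<open>An event that only depends on the order of the terms has the same probability for \<open>X\<close> and for
    the sequence space over the distribution of \<open>U\<close>.\<close>
  have transfer: "prob {\<omega> \<in> space M. Q (\<lambda>i. X i \<omega>)} = U.P.prob {x. Q x}"
    if Q: "\<And>x y. (\<And>i j. x i < x j \<longleftrightarrow> y i < y j) \<Longrightarrow> Q x \<longleftrightarrow> Q y"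
      and meas: "\<And>Y :: nat \<Rightarrow> 'a \<Rightarrow> real. (\<And>i. random_variable borel (Y i)) \<Longrightarrow> Measurable.pred M (\<lambda>\<omega>. Q (\<lambda>i. Y i \<omega>))"
      and meas_S: "Measurable.pred U.S Q"
    for Q :: "(nat \<Rightarrow> real) \<Rightarrow> bool"
  proof -
    have "AE \<omega> in M. Q (\<lambda>i. X i \<omega>) \<longleftrightarrow> Q (\<lambda>i. U i \<omega>)"
      using same_order by eventually_elim (rule Q, simp)
    then have "prob {\<omega> \<in> space M. Q (\<lambda>i. X i \<omega>)} = prob {\<omega> \<in> space M. Q (\<lambda>i. U i \<omega>)}"
      using meas[of X] meas[of U] by (intro measure_eq_AE) (auto simp: pred_def)
    also have "\<dots> = measure (distr M (Pi\<^sub>M UNIV (\<lambda>_. borel)) (\<lambda>\<omega> i. U i \<omega>)) {x. Q x}"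
    proof (subst measure_distr)
      show "(\<lambda>\<omega> i. U i \<omega>) \<in> measurable M (Pi\<^sub>M UNIV (\<lambda>_. borel))"
        by (rule measurable_PiM_single') auto
      show "{x. Q x} \<in> sets (Pi\<^sub>M UNIV (\<lambda>_. borel))"
        using U.Collect_in_sets_S[OF meas_S] by (simp flip: joint)
    qed (auto intro!: arg_cong[where f = prob])
    finally show ?thesis
      by (simp add: joint)
  qed
  have "prob_before M X [2, 1, 3, 4] [3, 2, 4, 1] = 1 / 2"
    unfolding prob_before_def first_occ_less_2134_3241
    unfolding U.prob_precedes_uniform(1)[OF cdf_U, symmetric]
    by (rule transfer, rule precedes_order_iso(1), simp, rule precedes_measurable_process(1), simp,
        rule U.precedes_measurable(1))
  moreover have "prob_before M X [3, 2, 4, 1] [2, 1, 3, 4] = 1 / 2"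
    unfolding prob_before_def first_occ_less_2134_3241
    unfolding U.prob_precedes_uniform(2)[OF cdf_U, symmetric]
    by (rule transfer, rule precedes_order_iso(2), simp, rule precedes_measurable_process(2), simp,
        rule U.precedes_measurable(2))
  ultimately show ?thesis
    by (simp add: tied_def)
qed

end
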